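(* Let $\mathcal{A}=\{x_1,\dots,x_M\}\subset\mathbb{C}$, $M\ge2$, be the unit-modulus $M$-PSK constellation, $x_p\ne x_q$ two of its points, $\bar x=x_p-x_q$, and $z_i=\mathrm{Re}\{x_i\bar x^*\}$ for $i=1,\dots,M$. Let $\epsilon\in(0,\frac{M-1}{M})$, $T=\ln\frac{(M-1)(1-\epsilon)}{\epsilon}>0$, $\bar\gamma_{s,d},\bar\gamma_{r,d}>0$. Let $t_0,t$ be the real random variables of the Gaussian (higher-order noise ignored) model described in the context when $x_q$ is transmitted, and let $f_{\mathrm{PL}}$ be the piecewise linear function defined there. Then the average pairwise error probability $P_e^{x_p,x_q}=\Pr\{t_0+f_{\mathrm{PL}}(t)>0\}$ of the piecewise linear decoder equals $I_1+I_2+I_3+I_4$, where, with $$A_{\pm}=\frac{1}{\bar\gamma_{s,d}}\int_0^\infty Q\Big(\frac{\pm T-z_q\gamma}{|\bar x|\sqrt{\gamma}}\Big)e^{-\gamma/\bar\gamma_{s,d}}\,d\gamma,\qquad B^{\pm}_i=\frac{1}{\bar\gamma_{r,d}}\int_0^\infty Q\Big(\frac{T\pm z_i\gamma}{|\bar x|\sqrt{\gamma}}\Big)e^{-\gamma/\bar\gamma_{r,d}}\,d\gamma,$$ $$I_1=(1-\epsilon)A_+B^+_q+\frac{\epsilon}{M-1}A_+\sum_{i\ne q}B^+_i,\qquad I_2=(1-\epsilon)A_-B^-_q+\frac{\epsilon}{M-1}A_-\sum_{i\ne q}B^-_i,$$ $$I_3=\frac{1-\epsilon}{\bar\gamma_{s,d}\bar\gamma_{r,d}}\int_0^\infty\!\!\int_0^\infty\frac{1}{\sqrt{2\pi\gamma_{r,d}}\,|\bar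 x|}\int_{-T}^{T}e^{-\frac{(w-z_q\gamma_{r,d})^2}{2|\bar x|^2\gamma_{r,d}}}\,Q\Big(\frac{-w-z_q\gamma_{s,d}}{|\bar x|\sqrt{\gamma_{s,d}}}\Big)e^{-\frac{\gamma_{s,d}}{\bar\gamma_{s,d}}-\frac{\gamma_{r,d}}{\bar\gamma_{r,d}}}\,dw\,d\gamma_{r,d}\,d\gamma_{s,d},$$ $$I_4=\frac{\epsilon}{\bar\gamma_{s,d}\bar\gamma_{r,d}}\int_0^\infty\!\!\int_0^\infty\frac{1}{\sqrt{2\pi\gamma_{r,d}}\,|\bar x|(M-1)}\int_{-T}^{T}Q\Big(\frac{-w-z_q\gamma_{s,d}}{|\bar x|\sqrt{\gamma_{s,d}}}\Big)\sum_{i\ne q}e^{-\frac{(w-z_i\gamma_{r,d})^2}{2|\bar x|^2\gamma_{r,d}}}\,e^{-\frac{\gamma_{s,d}}{\bar\gamma_{s,d}}-\frac{\gamma_{r,d}}{\bar\gamma_{r,d}}}\,dw\,d\gamma_{r,d}\,d\gamma_{s,d}.$$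
   Context: $Q(x)=\frac{1}{\sqrt{2\pi}}\int_x^\infty e^{-u^2/2}\,du$. $f_{\mathrm{PL}}(t)=-T$ if $t<-T$, $f_{\mathrm{PL}}(t)=t$ if $-T\le t\le T$, and $f_{\mathrm{PL}}(t)=T$ if $t>T$. The decoder erroneously prefers $x_p$ to the transmitted $x_q$ when $t_0+f_{\mathrm{PL}}(t)>0$. Gaussian model when $x_q$ is transmitted. The relay's symbol $x_r$ equals $x_q$ with probability $1-\epsilon$ and equals each $x_i$, $i\ne q$, with probability $\epsilon/(M-1)$. The instantaneous SNRs $\gamma_{s,d},\gamma_{r,d}$ are exponentially distributed with means $\bar\gamma_{s,d},\bar\gamma_{r,d}$. The variables $x_r,\gamma_{s,d},\gamma_{r,d}$ are independent. Conditionally on $(x_r,\gamma_{s,d},\gamma_{r,d})$, $t_0$ and $t$ are independent real Gaussians with $t_0\sim\mathcal{N}(\gamma_{s,d}\mathrm{Re}\{x_q^*\bar x\},\,\gamma_{s,d}|\bar x|^2)$ and $t\sim\mathcal{N}(\gamma_{r,d}\mathrm{Re}\{x_r^*\bar x\},\,\gamma_{r,d}|\bar x|^2)$. *)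

theory Defs
  imports "HOL-Probability.Probability"
begin

definition Qfun :: "real \<Rightarrow> real" where
  "Qfun x = 1 / sqrt (2 * pi) * (LBINT u:{x..}. exp (- u\<^sup>2 / 2))"

definition f_PL :: "real \<Rightarrow> real \<Rightarrow> real" where
  "f_PL T t = (if t < - T then - T else if t \<le> T then t else T)"

text \<open>The phase offset \<open>\<theta>\<close> is arbitrary, since conventions for PSK constellations differ in it.\<close>

definition psk :: "nat \<Rightarrow> real \<Rightarrow> complex set" where
  "psk M \<theta> = (\<lambda>k. cis (\<theta> + 2 * pi * real k / real M)) ` {..<M}"

text \<open>Conditional probability of the event \<open>E\<close> given the random variable \<open>Y\<close>, as a function on the
  sample space (determined up to null sets).\<close>

definition cond_prob_given ::
    "'a measure \<Rightarrow> ('a \<Rightarrow> 'b::topological_space) \<Rightarrow> 'a set \<Rightarrow> 'a \<Rightarrow> real" where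
  "cond_prob_given \<Omega> Y E =
     real_cond_exp \<Omega> (vimage_algebra (space \<Omega>) Y borel) (indicat_real E)"

text \<open>Conditionally on \<open>Y\<close>, the variable \<open>X\<close> is Gaussian with mean \<open>\<mu>\<close> and variance \<open>v\<close>, both
  being functions of \<open>Y\<close>. The library's \<^const>\<open>normal_density\<close> takes the standard deviation,
  hence the square root.\<close>

definition cond_normal ::
    "'a measure \<Rightarrow> ('a \<Rightarrow> 'b::topological_space) \<Rightarrow> ('a \<Rightarrow> real) \<Rightarrow> ('b \<Rightarrow> real) \<Rightarrow> ('b \<Rightarrow> real) \<Rightarrow> bool" where
  "cond_normal \<Omega> Y X \<mu> v \<longleftrightarrow>
     X \<in> borel_measurable \<Omega> \<and>
     (\<forall>B \<in> sets borel. AE \<omega> in \<Omega>.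
        cond_prob_given \<Omega> Y {\<omega> \<in> space \<Omega>. X \<omega> \<in> B} \<omega> =
        measure (density lborel (\<lambda>s. ennreal (normal_density (\<mu> (Y \<omega>)) (sqrt (v (Y \<omega>))) s))) B)"

definition cond_indep ::
    "'a measure \<Rightarrow> ('a \<Rightarrow> 'b::topological_space) \<Rightarrow> ('a \<Rightarrow> real) \<Rightarrow> ('a \<Rightarrow> real) \<Rightarrow> bool" where
  "cond_indep \<Omega> Y X X' \<longleftrightarrow>
     (\<forall>B \<in> sets borel. \<forall>C \<in> sets borel. AE \<omega> in \<Omega>.
        cond_prob_given \<Omega> Y {\<omega> \<in> space \<Omega>. X \<omega> \<in> B \<and> X' \<omega> \<in> C} \<omega> =
        cond_prob_given \<Omega> Y {\<omega> \<in> space \<Omega>. X \<omega> \<in> B} \<omega> *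
        cond_prob_given \<Omega> Y {\<omega> \<in> space \<Omega>. X' \<omega> \<in> C} \<omega>)"

text \<open>The Gaussian model when \<open>x q\<close> is transmitted; \<open>gsd\<close> and \<open>grd\<close> are the instantaneous SNRs with
  means \<open>Gsd\<close> and \<open>Grd\<close>, and \<open>d\<close> is the difference of the two symbols compared. Mutual independence
  of \<open>xr\<close>, \<open>gsd\<close>, \<open>grd\<close> is stated with the SNRs viewed as complex-valued, because
  \<^const>\<open>prob_space.indep_vars\<close> needs a common value type; this does not change the
  generated sigma-algebras.\<close>

definition gaussian_relay_model ::
    "'a measure \<Rightarrow> nat \<Rightarrow> (nat \<Rightarrow> complex) \<Rightarrow> nat \<Rightarrow> complex \<Rightarrow> real \<Rightarrow> real \<Rightarrow> real \<Rightarrow>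
     ('a \<Rightarrow> complex) \<Rightarrow> ('a \<Rightarrow> real) \<Rightarrow> ('a \<Rightarrow> real) \<Rightarrow> ('a \<Rightarrow> real) \<Rightarrow> ('a \<Rightarrow> real) \<Rightarrow> bool" where
  "gaussian_relay_model \<Omega> M x q d \<epsilon> Gsd Grd xr gsd grd t0 t \<longleftrightarrow>
     prob_space \<Omega> \<and>
     measure \<Omega> {\<omega> \<in> space \<Omega>. xr \<omega> = x q} = 1 - \<epsilon> \<and>
     (\<forall>i \<in> {1..M} - {q}. measure \<Omega> {\<omega> \<in> space \<Omega>. xr \<omega> = x i} = \<epsilon> / (real M - 1)) \<and>
     distributed \<Omega> lborel gsd (\<lambda>s. ennreal (exponential_density (1 / Gsd) s)) \<and>
     distributed \<Omega> lborel grd (\<lambda>s. ennreal (exponential_density (1 / Grd) s)) \<and>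
     prob_space.indep_vars \<Omega> (\<lambda>_. borel)
       (\<lambda>k. [xr, \<lambda>\<omega>. complex_of_real (gsd \<omega>), \<lambda>\<omega>. complex_of_real (grd \<omega>)] ! k) {..<3::nat} \<and>
     (let Y = (\<lambda>\<omega>. (xr \<omega>, gsd \<omega>, grd \<omega>)) in
        cond_normal \<Omega> Y t0
          (\<lambda>(r, a, b). a * Re (cnj (x q) * d)) (\<lambda>(r, a, b). a * (cmod d)\<^sup>2) \<and>
        cond_normal \<Omega> Y t
          (\<lambda>(r, a, b). b * Re (cnj r * d)) (\<lambda>(r, a, b). b * (cmod d)\<^sup>2) \<and>
        cond_indep \<Omega> Y t0 t)"

end

theory Submission
  imports Defs
begin

text \<open>The conditional law of \<open>t0\<close> depends on \<open>gsd\<close> only and that of \<open>t\<close> on \<open>(xr, grd)\<close> only, and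
  these are independent; hence \<open>t0\<close> and \<open>t\<close> are independent even without conditioning, each with a
  density that is an exponential mixture of Gaussians. Clipping splits the error event according to
  \<open>t < - T\<close>, \<open>t > T\<close> and \<open>- T \<le> t \<le> T\<close>. On the first two parts the probability factors into two
  tail probabilities, which gives \<open>I1\<close> and \<open>I2\<close>; on the third, Tonelli's theorem brings the integral
  over \<open>t\<close> innermost, and separating the relay symbol \<open>x q\<close> from the others gives \<open>I3\<close> and \<open>I4\<close>.\<close>

subsection \<open>Gaussian tails and exponential mixtures\<close>

text \<open>The bridge from the Bochner integral defining \<open>Qfun\<close> to nonnegative
  integrals. The half-line is open here and closed in the definition, which differ by a null point;
  the open one fits events such as \<open>c < s\<close>.\<close>

lemma Qfun_nn_integral:
  "ennreal (Qfun x) = (\<integral>\<^sup>+u. ennreal (std_normal_density u) * indicator {x<..} u \<partial>lborel)"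
proof -
  interpret N: prob_space "density lborel std_normal_density"
    by (rule prob_space_normal_density) simp
  have "Qfun x = (\<integral>u. std_normal_density u * indicator {x..} u \<partial>lborel)"
    unfolding Qfun_def set_lebesgue_integral_def std_normal_density_def
    by (subst Bochner_Integration.integral_mult_right_zero[symmetric])
       (auto intro!: Bochner_Integration.integral_cong simp: indicator_def)
  moreover have "integrable lborel (\<lambda>u. std_normal_density u * indicator {x..} u)"
    by (rule integrable_real_mult_indicator) auto
  ultimately have "ennreal (Qfun x) = (\<integral>\<^sup>+u. ennreal (std_normal_density u * indicator {x..} u) \<partial>lborel)"
    by (simp add: nn_integral_eq_integral)
  also have "\<dots> = (\<integral>\<^sup>+u. ennreal (std_normal_density u) * indicator {x<..} u \<partial>lborel)"
    by (rule nn_integral_cong_AE, rule AE_mp[OF AE_lborel_singleton[of x]]) (auto simp: indicator_def)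
  finally show ?thesis .
qed

lemma Qfun_nonneg [simp]: "0 \<le> Qfun x"
  unfolding Qfun_def set_lebesgue_integral_def
  by (auto intro!: mult_nonneg_nonneg integral_nonneg_AE)

lemma Qfun_le_1: "Qfun x \<le> 1"
proof -
  interpret N: prob_space "density lborel std_normal_density"
    by (rule prob_space_normal_density) simp
  have "ennreal (Qfun x) = emeasure (density lborel std_normal_density) {x<..}"
    by (simp add: Qfun_nn_integral emeasure_density)
  also have "\<dots> \<le> ennreal 1" using N.emeasure_le_1 by simp
  finally show ?thesis by (simp del: ennreal_1)
qed

lemma borel_measurable_Qfun [measurable]: "Qfun \<in> borel_measurable borel"
proof -
  \<comment> \<open>With the condition \<open>x < u\<close> in place of an indicator of a set
    depending on \<open>x\<close>, the integrand is visibly measurable in \<open>x\<close> and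
    \<open>u\<close> jointly.\<close>
  have eq: "Qfun = (\<lambda>x. enn2real (\<integral>\<^sup>+u. ennreal (std_normal_density u) * (if x < u then 1 else 0) \<partial>lborel))"
  proof
    fix x
    have "Qfun x = enn2real (ennreal (Qfun x))" by simp
    then show "Qfun x = enn2real (\<integral>\<^sup>+u. ennreal (std_normal_density u) * (if x < u then 1 else 0) \<partial>lborel)"
      unfolding Qfun_nn_integral by (simp add: indicator_def if_distrib of_bool_def)
  qed
  show ?thesis by (subst eq) measurable
qed

text \<open>Substitution \<open>s = \<mu> + c * u\<close>. The sign of \<open>c\<close> is left
  free: \<open>c = \<sigma>\<close> handles upper tails, and the reflection
  \<open>c = - \<sigma>\<close> turns lower tails into upper ones, so that both become values of
  \<open>Qfun\<close>.\<close>

lemma nn_integral_normal_density_affine: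
  assumes "\<sigma> > 0" "\<bar>c\<bar> = \<sigma>" and [measurable]: "S \<in> sets borel"
  shows "(\<integral>\<^sup>+s. ennreal (normal_density \<mu> \<sigma> s) * indicator S s \<partial>lborel) =
    (\<integral>\<^sup>+u. ennreal (std_normal_density u) * indicator S (\<mu> + c * u) \<partial>lborel)"
proof -
  have c: "c \<noteq> 0" using assms by auto
  have c2: "c\<^sup>2 = \<sigma>\<^sup>2" using assms by (metis power2_abs)
  have n: "normal_density \<mu> \<sigma> (\<mu> + c * u) = std_normal_density u / \<sigma>" for u
    using assms(1) by (simp add: normal_density_def power_mult_distrib c2 real_sqrt_mult)
  have "(\<integral>\<^sup>+s. ennreal (normal_density \<mu> \<sigma> s) * indicator S s \<partial>lborel) =
     (\<integral>\<^sup>+u. ennreal \<sigma> * (ennreal (std_normal_density u / \<sigma>) * indicator S (\<mu> + c * u)) \<partial>lborel)"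
    by (subst nn_integral_real_affine[OF _ c, of _ \<mu>])
       (simp_all add: n assms(2) nn_integral_cmult)
  also have "\<dots> = (\<integral>\<^sup>+u. ennreal (std_normal_density u) * indicator S (\<mu> + c * u) \<partial>lborel)"
    using assms(1)
    by (intro nn_integral_cong) (auto simp flip: mult.assoc ennreal_mult)
  finally show ?thesis .
qed

lemma nn_integral_normal_density_greaterThan:
  assumes "\<sigma> > 0"
  shows "(\<integral>\<^sup>+s. ennreal (normal_density \<mu> \<sigma> s) * indicator {c<..} s \<partial>lborel) =
    ennreal (Qfun ((c - \<mu>) / \<sigma>))"
proof -
  have "indicator {c<..} (\<mu> + \<sigma> * u) = (indicator {(c - \<mu>) / \<sigma><..} u :: ennreal)" for u
    using assms by (auto simp: indicator_def field_simps)
  then show ?thesis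
    using assms by (simp add: nn_integral_normal_density_affine[of \<sigma> \<sigma>] Qfun_nn_integral)
qed

lemma nn_integral_normal_density_lessThan:
  assumes "\<sigma> > 0"
  shows "(\<integral>\<^sup>+s. ennreal (normal_density \<mu> \<sigma> s) * indicator {..<c} s \<partial>lborel) =
    ennreal (Qfun ((\<mu> - c) / \<sigma>))"
proof -
  have "indicator {..<c} (\<mu> + (- \<sigma>) * u) = (indicator {(\<mu> - c) / \<sigma><..} u :: ennreal)" for u
    using assms by (auto simp: indicator_def field_simps)
  then show ?thesis
    using assms by (subst nn_integral_normal_density_affine[of \<sigma> "-\<sigma>"]) (simp_all add: Qfun_nn_integral)
qed

text \<open>Mean and deviation will depend on the SNR, so interchanging integrals requires
  measurability in all arguments jointly.\<close>

lemma borel_measurable_normal_density_comp [measurable]: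
  assumes [measurable]: "f \<in> borel_measurable M" "g \<in> borel_measurable M" "h \<in> borel_measurable M"
  shows "(\<lambda>x. normal_density (f x) (g x) (h x)) \<in> borel_measurable M"
  unfolding normal_density_def by measurable

lemma nn_integral_normal_density:
  assumes "\<sigma> > 0"
  shows "(\<integral>\<^sup>+s. ennreal (normal_density \<mu> \<sigma> s) \<partial>lborel) = 1"
proof -
  interpret N: prob_space "density lborel (normal_density \<mu> \<sigma>)"
    using assms by (rule prob_space_normal_density)
  show ?thesis using N.emeasure_space_1 by (simp add: emeasure_density)
qed

lemma nn_integral_exponential_density:
  assumes "l > 0"
  shows "(\<integral>\<^sup>+s. ennreal (exponential_density l s) \<partial>lborel) = 1"
proof -
  interpret N: prob_space "density lborel (exponential_density l)"
    using assms by (rule prob_space_exponential_density)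
  show ?thesis using N.emeasure_space_1 by (simp add: emeasure_density)
qed

section \<open>Exponential fading of Gaussian laws: tails and the unclipped region\<close>

lemma set_integral_nonneg_pointwise:
  fixes f :: "'a \<Rightarrow> real"
  assumes "\<And>x. x \<in> A \<Longrightarrow> 0 \<le> f x"
  shows "0 \<le> (LINT x:A|M. f x)"
  unfolding set_lebesgue_integral_def
  by (rule integral_nonneg_AE) (use assms in \<open>auto simp: indicator_def\<close>)

text \<open>The Bochner integral of a nonnegative function is \<open>enn2real\<close> of its
  nonnegative integral, which is 0 if the latter is infinite. Finiteness is what makes this passage
  reversible.\<close>

lemma ennreal_set_integral:
  assumes "f \<in> borel_measurable lborel" "A \<in> sets lborel" "\<And>x. x \<in> A \<Longrightarrow> 0 \<le> f x"
    and "(\<integral>\<^sup>+x. ennreal (f x) * indicator A x \<partial>lborel) < \<infinity>"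
  shows "ennreal (LBINT x:A. f x) = (\<integral>\<^sup>+x. ennreal (f x) * indicator A x \<partial>lborel)"
proof -
  have eq: "ennreal (indicator A x * f x) = ennreal (f x) * indicator A x" for x
    by (simp add: indicator_def)
  have nn: "AE x in lborel. 0 \<le> indicator A x *\<^sub>R f x" using assms(3) by (simp add: indicator_def)
  have m: "(\<lambda>x. indicator A x *\<^sub>R f x) \<in> borel_measurable lborel" using assms(1,2) by measurable
  show ?thesis
    unfolding set_lebesgue_integral_def
    by (subst integral_eq_nn_integral[OF m nn]) (use assms(4) in \<open>simp add: eq\<close>)
qed

text \<open>The density of a Gaussian whose SNR \<open>b\<close> is exponential with mean \<open>G\<close>. For \<open>b < 0\<close> the argument
  of the square root is negative, but then the exponential density vanishes.\<close>

definition fading_density :: "real \<Rightarrow> real \<Rightarrow> real \<Rightarrow> real \<Rightarrow> ennreal" where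
  "fading_density G z d s = (\<integral>\<^sup>+b. ennreal (exponential_density (1 / G) b) *
     ennreal (normal_density (b * z) (sqrt (b * d\<^sup>2)) s) \<partial>lborel)"

lemma borel_measurable_fading_density [measurable]:
  "fading_density G z d \<in> borel_measurable borel"
  unfolding fading_density_def by measurable

text \<open>Tonelli's theorem; it reduces every question about the mixture to a Gaussian of fixed
  SNR.\<close>

lemma nn_integral_fading_density:
  assumes [measurable]: "f \<in> borel_measurable borel"
  shows "(\<integral>\<^sup>+s. fading_density G z d s * f s \<partial>lborel) =
    (\<integral>\<^sup>+b. ennreal (exponential_density (1 / G) b) *
      (\<integral>\<^sup>+s. ennreal (normal_density (b * z) (sqrt (b * d\<^sup>2)) s) * f s \<partial>lborel) \<partial>lborel)"
proof -
  have "(\<integral>\<^sup>+s. fading_density G z d s * f s \<partial>lborel) =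
     (\<integral>\<^sup>+s. \<integral>\<^sup>+b. ennreal (exponential_density (1 / G) b) *
      (ennreal (normal_density (b * z) (sqrt (b * d\<^sup>2)) s) * f s) \<partial>lborel \<partial>lborel)"
    by (simp add: fading_density_def nn_integral_multc[symmetric] mult.assoc)
  also have "\<dots> = (\<integral>\<^sup>+b. \<integral>\<^sup>+s. ennreal (exponential_density (1 / G) b) *
      (ennreal (normal_density (b * z) (sqrt (b * d\<^sup>2)) s) * f s) \<partial>lborel \<partial>lborel)"
    by (rule lborel_pair.Fubini') measurable
  also have "\<dots> = (\<integral>\<^sup>+b. ennreal (exponential_density (1 / G) b) *
      (\<integral>\<^sup>+s. ennreal (normal_density (b * z) (sqrt (b * d\<^sup>2)) s) * f s \<partial>lborel) \<partial>lborel)"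
    by (simp add: nn_integral_cmult)
  finally show ?thesis .
qed

text \<open>The exponential density has mass 1, so the bound \<open>C\<close> on \<open>g\<close>
  bounds the average as well; the average is then finite and may be written as a real integral.
  Agreement of \<open>F\<close> with \<open>g\<close> on \<open>b > 0\<close> suffices, because the
  rest carries no mass. The second claim lets the lemma be iterated, supplying the bound for the
  next outer integral.\<close>

lemma nn_integral_exponential_density_eq:
  assumes G: "G > 0" and [measurable]: "g \<in> borel_measurable lborel"
    and g: "\<And>b. 0 < b \<Longrightarrow> 0 \<le> g b \<and> g b \<le> C"
    and F: "\<And>b. 0 < b \<Longrightarrow> F b = ennreal (g b)"
  shows "(\<integral>\<^sup>+b. ennreal (exponential_density (1 / G) b) * F b \<partial>lborel) =
    ennreal (1 / G * (LBINT b:{0<..}. g b * exp (- b / G)))" (is "?L = _")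
    and "(\<integral>\<^sup>+b. ennreal (exponential_density (1 / G) b) * F b \<partial>lborel) \<le> ennreal C"
proof -
  have L: "?L = (\<integral>\<^sup>+b. ennreal (1 / G) * (ennreal (g b * exp (- b / G)) * indicator {0<..} b) \<partial>lborel)"
  \<comment> \<open>The null point 0 must be removed: the exponential density is positive there,
    while the indicator of \<open>{0<..}\<close> vanishes.\<close>
  proof (rule nn_integral_cong_AE, rule AE_mp[OF AE_lborel_singleton[of 0]], rule AE_I2, rule impI)
    fix b :: real assume "b \<noteq> 0"
    then show "ennreal (exponential_density (1 / G) b) * F b =
      ennreal (1 / G) * (ennreal (g b * exp (- b / G)) * indicator {0<..} b)"
      using G g[of b] F[of b]
      by (cases "b > 0") (auto simp: exponential_density_def ac_simps simp flip: ennreal_mult)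
  qed
  also have "\<dots> = ennreal (1 / G) * (\<integral>\<^sup>+b. ennreal (g b * exp (- b / G)) * indicator {0<..} b \<partial>lborel)"
    by (rule nn_integral_cmult) measurable
  finally have L1: "?L = ennreal (1 / G) * (\<integral>\<^sup>+b. ennreal (g b * exp (- b / G)) * indicator {0<..} b \<partial>lborel)" .
  have "?L \<le> (\<integral>\<^sup>+b. ennreal (exponential_density (1 / G) b) * ennreal C \<partial>lborel)"
  proof (rule nn_integral_mono_AE, rule AE_mp[OF AE_lborel_singleton[of 0]], rule AE_I2, rule impI)
    fix b :: real assume "b \<noteq> 0"
    then show "ennreal (exponential_density (1 / G) b) * F b \<le> ennreal (exponential_density (1 / G) b) * ennreal C"
      using g[of b] F[of b] 
      by (cases "b > 0") (auto simp: exponential_density_def intro!: mult_left_mono ennreal_leI)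
  qed
  also have "\<dots> = ennreal C"
    using nn_integral_exponential_density[of "1 / G"] G by (simp add: nn_integral_multc)
  finally show le: "?L \<le> ennreal C" .
  then have "?L < \<infinity>" by (simp add: order_le_less_trans)
  then have fin: "(\<integral>\<^sup>+b. ennreal (g b * exp (- b / G)) * indicator {0<..} b \<partial>lborel) < \<infinity>"
    using G unfolding L1 by (auto simp: ennreal_mult_less_top)
  have "ennreal (LBINT b:{0<..}. g b * exp (- b / G)) =
      (\<integral>\<^sup>+b. ennreal (g b * exp (- b / G)) * indicator {0<..} b \<partial>lborel)"
    by (rule ennreal_set_integral) (use g fin in auto)
  moreover have "0 \<le> (LBINT b:{0<..}. g b * exp (- b / G))"
    unfolding set_lebesgue_integral_def using g
    by (intro integral_nonneg_AE) (auto simp: indicator_def)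
  ultimately show "?L = ennreal (1 / G * (LBINT b:{0<..}. g b * exp (- b / G)))"
    using L1 G by (subst ennreal_mult) (simp_all del: times_divide_eq_left)
qed

text \<open>The average over the SNR is left as a nonnegative integral, because in the unclipped
  region it is integrated further over the threshold. The point \<open>b = 0\<close> is discarded as
  null, since the Gaussian degenerates there.\<close>

lemma fading_density_greaterThan_mixture:
  assumes "d > 0"
  shows "(\<integral>\<^sup>+s. fading_density G z d s * indicator {c<..} s \<partial>lborel) =
    (\<integral>\<^sup>+b. ennreal (exponential_density (1 / G) b) * ennreal (Qfun ((c - z * b) / (d * sqrt b))) \<partial>lborel)"
  unfolding nn_integral_fading_density[OF borel_measurable_indicator[OF borel_open[OF open_greaterThan]]]
proof (rule nn_integral_cong_AE, rule AE_mp[OF AE_lborel_singleton[of 0]], rule AE_I2, rule impI)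
  fix b :: real assume "b \<noteq> 0"
  then show "ennreal (exponential_density (1 / G) b) *
      (\<integral>\<^sup>+s. ennreal (normal_density (b * z) (sqrt (b * d\<^sup>2)) s) * indicator {c<..} s \<partial>lborel) =
      ennreal (exponential_density (1 / G) b) * ennreal (Qfun ((c - z * b) / (d * sqrt b)))"
    using assms
    by (cases "b > 0") (auto simp: nn_integral_normal_density_greaterThan exponential_density_def
        real_sqrt_mult mult.commute[of d] mult.commute[of z])
qed

lemma fading_density_greaterThan:
  assumes "G > 0" "d > 0"
  shows "(\<integral>\<^sup>+s. fading_density G z d s * indicator {c<..} s \<partial>lborel) =
    ennreal (1 / G * (LBINT b:{0<..}. Qfun ((c - z * b) / (d * sqrt b)) * exp (- b / G)))"
  unfolding fading_density_greaterThan_mixture[OF assms(2)]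
  by (rule nn_integral_exponential_density_eq(1)[where C = 1]) (use assms in \<open>auto simp: Qfun_le_1\<close>)

lemma fading_density_lessThan:
  assumes "G > 0" "d > 0"
  shows "(\<integral>\<^sup>+s. fading_density G z d s * indicator {..<c} s \<partial>lborel) =
    ennreal (1 / G * (LBINT b:{0<..}. Qfun ((z * b - c) / (d * sqrt b)) * exp (- b / G)))"
  unfolding nn_integral_fading_density[OF borel_measurable_indicator[OF borel_open[OF open_lessThan]]]
  by (rule nn_integral_exponential_density_eq(1)[where C = 1])
     (use assms in \<open>auto simp: nn_integral_normal_density_lessThan Qfun_le_1 real_sqrt_mult
       mult.commute[of d] mult.commute[of z]\<close>)

lemma nn_integral_fading_density_UNIV:
  assumes "G > 0" "d > 0"
  shows "(\<integral>\<^sup>+s. fading_density G z d s \<partial>lborel) = 1"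
proof -
  have "(\<integral>\<^sup>+s. fading_density G z d s \<partial>lborel) = (\<integral>\<^sup>+b. ennreal (exponential_density (1 / G) b) *
      (\<integral>\<^sup>+s. ennreal (normal_density (b * z) (sqrt (b * d\<^sup>2)) s) \<partial>lborel) \<partial>lborel)"
    using nn_integral_fading_density[of "\<lambda>_. 1"] by simp
  also have "\<dots> = (\<integral>\<^sup>+b. ennreal (exponential_density (1 / G) b) \<partial>lborel)"
  proof (rule nn_integral_cong_AE, rule AE_mp[OF AE_lborel_singleton[of 0]], rule AE_I2, rule impI)
    fix b :: real assume "b \<noteq> 0"
    then show "ennreal (exponential_density (1 / G) b) *
        (\<integral>\<^sup>+s. ennreal (normal_density (b * z) (sqrt (b * d\<^sup>2)) s) \<partial>lborel) =
        ennreal (exponential_density (1 / G) b)"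
      using assms by (cases "b > 0") (auto simp: nn_integral_normal_density exponential_density_def)
  qed
  finally show ?thesis using assms by (simp add: nn_integral_exponential_density)
qed

text \<open>The factor \<open>k\<close> cancels; it is there because the integrand of \<open>I4\<close> contains \<open>1 / (M - 1)\<close>.\<close>

lemma middle_region_integral:
  fixes z :: "nat \<Rightarrow> real"
  assumes G: "Gs > 0" "Gr > 0" and d: "d > 0" and k: "k > 0" and S: "finite S"
  shows "(\<integral>\<^sup>+w. (\<Sum>i\<in>S. fading_density Gr (z i) d w) *
      ((\<integral>\<^sup>+a. ennreal (exponential_density (1 / Gs) a) *
          ennreal (Qfun ((- w - y * a) / (d * sqrt a))) \<partial>lborel) * indicator {-T..T} w) \<partial>lborel) =
    ennreal (k / (Gs * Gr) *
      (LBINT a:{0<..}. LBINT b:{0<..}. 1 / (sqrt (2 * pi * b) * d * k) *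
        (LBINT w:{-T..T}. Qfun ((- w - y * a) / (d * sqrt a)) *
           (\<Sum>i\<in>S. exp (- (w - z i * b)\<^sup>2 / (2 * d\<^sup>2 * b))) * exp (- a / Gs - b / Gr))))"
proof -
  define q where "q a w = Qfun ((- w - y * a) / (d * sqrt a))" for a w
  define n where "n i b w = normal_density (b * z i) (sqrt (b * d\<^sup>2)) w" for i b w
  define h where "h a b w = q a w * (\<Sum>i\<in>S. n i b w)" for a b w
  \<comment> \<open>\<open>g2\<close> and \<open>g1\<close> are the real integrals over
    \<open>w\<close> and then over \<open>b\<close>. Each needs a uniform bound before the next
    integration can be written as a real integral.\<close>
  define g2 where "g2 a b = (LBINT w:{-T..T}. h a b w)" for a b
  define g1 where "g1 a = 1 / Gr * (LBINT b:{0<..}. g2 a b * exp (- b / Gr))" for a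
  have [measurable]: "case_prod q \<in> borel_measurable (lborel \<Otimes>\<^sub>M lborel)"
    unfolding q_def by measurable
  have [measurable]: "case_prod (n i) \<in> borel_measurable (lborel \<Otimes>\<^sub>M lborel)" for i
    unfolding n_def by measurable
  have [measurable]: "(\<lambda>(a, b, w). h a b w) \<in> borel_measurable (lborel \<Otimes>\<^sub>M lborel \<Otimes>\<^sub>M lborel)"
    unfolding h_def by measurable
  have [measurable]: "case_prod g2 \<in> borel_measurable (lborel \<Otimes>\<^sub>M lborel)"
    unfolding g2_def h_def set_lebesgue_integral_def by measurable
  have [measurable]: "g1 \<in> borel_measurable lborel"
    unfolding g1_def set_lebesgue_integral_def by measurable
  have q0: "0 \<le> q a w" and q1: "q a w \<le> 1" for a w by (simp_all add: q_def Qfun_le_1)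
  have n0: "0 \<le> n i b w" for i b w by (simp add: n_def)
  have h0: "0 \<le> h a b w" for a b w by (simp add: h_def q0 n0 sum_nonneg)
  have g20: "0 \<le> g2 a b" for a b
    unfolding g2_def set_lebesgue_integral_def by (auto intro!: integral_nonneg_AE simp: h0)
  have g10: "0 \<le> g1 a" for a
    unfolding g1_def set_lebesgue_integral_def using G
    by (auto intro!: mult_nonneg_nonneg integral_nonneg_AE simp: g20)
  \<comment> \<open>\<open>Qfun\<close> is at most 1 and each Gaussian has mass 1, so each index in
    \<open>S\<close> contributes at most 1.\<close>
  have h_bound: "(\<integral>\<^sup>+w. ennreal (h a b w) * indicator {-T..T} w \<partial>lborel) \<le> ennreal (card S)"
    if "b > 0" for a b
  proof -
    have "ennreal (h a b w) * indicator {-T..T} w \<le> (\<Sum>i\<in>S. ennreal (n i b w))" for w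
    proof -
      have "h a b w \<le> 1 * (\<Sum>i\<in>S. n i b w)"
        unfolding h_def by (intro mult_right_mono q1 sum_nonneg n0)
      then have "ennreal (h a b w) \<le> (\<Sum>i\<in>S. ennreal (n i b w))"
        by (simp add: sum_ennreal n0 ennreal_leI)
      then show ?thesis by (auto simp: indicator_def)
    qed
    then have "(\<integral>\<^sup>+w. ennreal (h a b w) * indicator {-T..T} w \<partial>lborel) \<le>
        (\<integral>\<^sup>+w. (\<Sum>i\<in>S. ennreal (n i b w)) \<partial>lborel)"
      by (rule nn_integral_mono)
    also have "\<dots> = (\<Sum>i\<in>S. \<integral>\<^sup>+w. ennreal (n i b w) \<partial>lborel)"
      by (rule nn_integral_sum) measurable
    also have "\<dots> = ennreal (card S)"
      using that d by (simp add: n_def nn_integral_normal_density ennreal_of_nat_eq_real_of_nat)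
    finally show ?thesis .
  qed
  have g2: "ennreal (g2 a b) = (\<integral>\<^sup>+w. ennreal (h a b w) * indicator {-T..T} w \<partial>lborel)" if "b > 0" for a b
    unfolding g2_def
    by (rule ennreal_set_integral)
       (use h0 order_le_less_trans[OF h_bound[OF that] ennreal_less_top] in auto)
  have g2_le: "g2 a b \<le> card S" if "b > 0" for a b
    using h_bound[OF that, of a] g2[OF that, of a] by (metis ennreal_le_iff of_nat_0_le_iff)
  \<comment> \<open>The extended-valued counterpart of \<open>g2\<close>. The two agree for
    \<open>b > 0\<close>, and \<open>H\<close> can be interchanged and summed without integrability
    conditions.\<close>
  define H where "H a b = (\<integral>\<^sup>+w. ennreal (h a b w) * indicator {-T..T} w \<partial>lborel)" for a b
  have [measurable]: "case_prod H \<in> borel_measurable (lborel \<Otimes>\<^sub>M lborel)"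
    unfolding H_def h_def by measurable
  note b_step = nn_integral_exponential_density_eq[OF G(2), of "g2 a" "real (card S)" "H a" for a]
  have g1: "(\<integral>\<^sup>+b. ennreal (exponential_density (1 / Gr) b) * H a b \<partial>lborel) = ennreal (g1 a)" for a
    unfolding g1_def by (rule b_step(1)) (auto simp: g20 g2_le g2 H_def)
  have "(\<integral>\<^sup>+b. ennreal (exponential_density (1 / Gr) b) * H a b \<partial>lborel) \<le> ennreal (card S)" for a
    by (rule b_step(2)) (auto simp: g20 g2_le g2 H_def)
  then have g1_le: "g1 a \<le> card S" for a
    unfolding g1 by simp
  have total: "(\<integral>\<^sup>+a. ennreal (exponential_density (1 / Gs) a) * ennreal (g1 a) \<partial>lborel) =
      ennreal (1 / Gs * (LBINT a:{0<..}. g1 a * exp (- a / Gs)))"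
    by (rule nn_integral_exponential_density_eq(1)[OF G(1), where C = "card S"])
       (auto simp: g10 g1_le)
  define F where "F w = (\<integral>\<^sup>+a. ennreal (exponential_density (1 / Gs) a) * ennreal (q a w) \<partial>lborel)" for w
  have [measurable]: "F \<in> borel_measurable borel"
    unfolding F_def by measurable
  let ?ind = "indicator {-T..T} :: real \<Rightarrow> ennreal"
  let ?es = "\<lambda>a. ennreal (exponential_density (1 / Gs) a)"
  let ?er = "\<lambda>b. ennreal (exponential_density (1 / Gr) b)"
  define Hi where "Hi i a b = (\<integral>\<^sup>+w. ennreal (q a w * n i b w) * ?ind w \<partial>lborel)" for i a b
  have [measurable]: "case_prod (Hi i) \<in> borel_measurable (lborel \<Otimes>\<^sub>M lborel)" for i
    unfolding Hi_def by measurable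
  have H_sum: "H a b = (\<Sum>i\<in>S. Hi i a b)" for a b
  proof -
    have "ennreal (h a b w) = (\<Sum>i\<in>S. ennreal (q a w * n i b w))" for w
      by (simp add: h_def sum_distrib_left q0 n0)
    then show ?thesis
      unfolding H_def Hi_def by (simp only: sum_distrib_right) (rule nn_integral_sum, measurable)
  qed
  \<comment> \<open>\<open>F\<close> hides the integral over \<open>a\<close>; this moves it outside
    the integral over \<open>w\<close>, one index at a time.\<close>
  have swap: "(\<integral>\<^sup>+w. ennreal (n i b w) * (F w * ?ind w) \<partial>lborel) =
     (\<integral>\<^sup>+a. ?es a * Hi i a b \<partial>lborel)" for i b
  proof -
    have "(\<integral>\<^sup>+w. ennreal (n i b w) * (F w * ?ind w) \<partial>lborel) =
       (\<integral>\<^sup>+w. \<integral>\<^sup>+a. ?es a * (ennreal (q a w * n i b w) * ?ind w) \<partial>lborel \<partial>lborel)"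
      unfolding F_def
      by (intro nn_integral_cong)
         (simp add: nn_integral_multc[symmetric] nn_integral_cmult[symmetric] q0 n0 ennreal_mult ac_simps)
    also have "\<dots> = (\<integral>\<^sup>+a. \<integral>\<^sup>+w. ?es a * (ennreal (q a w * n i b w) * ?ind w) \<partial>lborel \<partial>lborel)"
      by (rule lborel_pair.Fubini') measurable
    finally show ?thesis by (simp add: nn_integral_cmult Hi_def)
  qed
  \<comment> \<open>The integral over \<open>w\<close> starts outermost, with those over
    \<open>b\<close> and \<open>a\<close> hidden in \<open>fading_density\<close> and
    \<open>F\<close>. Pull out \<open>b\<close>, then \<open>a\<close>, recombine the sum into
    \<open>H\<close>, and finally exchange \<open>a\<close> and \<open>b\<close> so that
    \<open>a\<close> is outermost.\<close>
  have "(\<integral>\<^sup>+w. (\<Sum>i\<in>S. fading_density Gr (z i) d w) * (F w * ?ind w) \<partial>lborel) =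
      (\<Sum>i\<in>S. \<integral>\<^sup>+w. fading_density Gr (z i) d w * (F w * ?ind w) \<partial>lborel)"
    by (subst nn_integral_sum[symmetric]) (simp_all add: sum_distrib_right)
  also have "\<dots> = (\<Sum>i\<in>S. \<integral>\<^sup>+b. ?er b * (\<integral>\<^sup>+w. ennreal (n i b w) * (F w * ?ind w) \<partial>lborel) \<partial>lborel)"
    by (simp add: nn_integral_fading_density n_def)
  also have "\<dots> = (\<Sum>i\<in>S. \<integral>\<^sup>+b. \<integral>\<^sup>+a. ?er b * (?es a * Hi i a b) \<partial>lborel \<partial>lborel)"
    unfolding swap by (simp add: nn_integral_cmult)
  also have "\<dots> = (\<integral>\<^sup>+b. \<integral>\<^sup>+a. ?es a * (?er b * H a b) \<partial>lborel \<partial>lborel)"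
    by (simp add: H_sum sum_distrib_left nn_integral_sum mult.left_commute)
  also have "\<dots> = (\<integral>\<^sup>+a. \<integral>\<^sup>+b. ?es a * (?er b * H a b) \<partial>lborel \<partial>lborel)"
    by (rule lborel_pair.Fubini') measurable
  also have "\<dots> = (\<integral>\<^sup>+a. ?es a * ennreal (g1 a) \<partial>lborel)"
    by (simp add: nn_integral_cmult g1)
  also note total
  \<comment> \<open>For \<open>b > 0\<close> the Gaussian prefactor is
    \<open>1 / (sqrt (2 * pi * b) * d)\<close>, and the joint exponential splits into a factor in
    \<open>a\<close> and one in \<open>b\<close>. The inner integral then equals
    \<open>Gr / k\<close> times the integrand on the left, and \<open>k / (Gs * Gr)\<close> restores
    \<open>1 / Gs\<close>.\<close>
  also have "1 / Gs * (LBINT a:{0<..}. g1 a * exp (- a / Gs)) = k / (Gs * Gr) *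
      (LBINT a:{0<..}. LBINT b:{0<..}. 1 / (sqrt (2 * pi * b) * d * k) *
        (LBINT w:{-T..T}. q a w *
           (\<Sum>i\<in>S. exp (- (w - z i * b)\<^sup>2 / (2 * d\<^sup>2 * b))) * exp (- a / Gs - b / Gr)))"
  proof -
    have e: "1 / (sqrt (2 * pi * b) * d * k) * (LBINT w:{-T..T}. q a w *
           (\<Sum>i\<in>S. exp (- (w - z i * b)\<^sup>2 / (2 * d\<^sup>2 * b))) * exp (- a / Gs - b / Gr)) =
         (1 / k * exp (- a / Gs)) * (g2 a b * exp (- b / Gr))" if b: "b > 0" for a b
    proof -
      have "n i b w = 1 / (sqrt (2 * pi * b) * d) * exp (- (w - z i * b)\<^sup>2 / (2 * d\<^sup>2 * b))" for i w
        using b d by (simp add: n_def normal_density_def real_sqrt_mult power_mult_distrib ac_simps)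
      then have "h a b = (\<lambda>w. 1 / (sqrt (2 * pi * b) * d) *
          (q a w * (\<Sum>i\<in>S. exp (- (w - z i * b)\<^sup>2 / (2 * d\<^sup>2 * b)))))"
        by (simp add: fun_eq_iff h_def sum_divide_distrib[symmetric])
      then have "g2 a b = 1 / (sqrt (2 * pi * b) * d) *
          (LBINT w:{-T..T}. q a w * (\<Sum>i\<in>S. exp (- (w - z i * b)\<^sup>2 / (2 * d\<^sup>2 * b))))"
        unfolding g2_def by (simp only: set_integral_mult_right)
      moreover have "exp (- a / Gs - b / Gr) = exp (- a / Gs) * exp (- b / Gr)"
        by (simp flip: exp_add)
      ultimately show ?thesis
        by (simp only: set_integral_mult_left) (simp add: ac_simps)
    qed
    have "(LBINT b:{0<..}. 1 / (sqrt (2 * pi * b) * d * k) *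
        (LBINT w:{-T..T}. q a w *
           (\<Sum>i\<in>S. exp (- (w - z i * b)\<^sup>2 / (2 * d\<^sup>2 * b))) * exp (- a / Gs - b / Gr))) =
        Gr / k * (g1 a * exp (- a / Gs))" for a
    proof -
      have "(LBINT b:{0<..}. 1 / (sqrt (2 * pi * b) * d * k) *
        (LBINT w:{-T..T}. q a w *
           (\<Sum>i\<in>S. exp (- (w - z i * b)\<^sup>2 / (2 * d\<^sup>2 * b))) * exp (- a / Gs - b / Gr))) =
        (LBINT b:{0<..}. (1 / k * exp (- a / Gs)) * (g2 a b * exp (- b / Gr)))"
        by (rule set_lebesgue_integral_cong) (use e in auto)
      also have "\<dots> = (1 / k * exp (- a / Gs)) * (LBINT b:{0<..}. g2 a b * exp (- b / Gr))"
        by (rule set_integral_mult_right)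
      finally show ?thesis using G by (simp add: g1_def)
    qed
    then show ?thesis using G k by (simp only: set_integral_mult_right) simp
  qed
  finally show ?thesis unfolding F_def q_def .
qed

subsection \<open>The joint law of the decision variables\<close>

text \<open>\<open>v\<close> is the variance. The \<open>ennreal\<close> values allow the mass to be
  averaged over random parameters without integrability conditions.\<close>

definition gauss_mass :: "real \<Rightarrow> real \<Rightarrow> real set \<Rightarrow> ennreal" where
  "gauss_mass \<mu> v B = (\<integral>\<^sup>+s. ennreal (normal_density \<mu> (sqrt v) s) * indicator B s \<partial>lborel)"

lemma borel_measurable_gauss_mass [measurable]:
  assumes [measurable]: "B \<in> sets borel" "f \<in> borel_measurable M" "g \<in> borel_measurable M"
  shows "(\<lambda>x. gauss_mass (f x) (g x) B) \<in> borel_measurable M"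
  unfolding gauss_mass_def by measurable

lemma emeasure_normal:
  assumes "B \<in> sets borel"
  shows "emeasure (density lborel (\<lambda>s. ennreal (normal_density \<mu> (sqrt v) s))) B = gauss_mass \<mu> v B"
  using assms by (simp add: emeasure_density gauss_mass_def)

lemma gauss_mass_le_1:
  assumes "v > 0" "B \<in> sets borel"
  shows "gauss_mass \<mu> v B \<le> 1"
proof -
  interpret N: prob_space "density lborel (normal_density \<mu> (sqrt v))"
    using assms by (intro prob_space_normal_density) simp
  show ?thesis using N.emeasure_le_1[of B] by (simp add: emeasure_normal assms(2))
qed

text \<open>A probability is the expectation of the conditional probability, which almost surely
  factors by conditional independence into two Gaussian masses evaluated at
  \<open>Y\<close>.\<close>

lemma (in prob_space) cond_normal_rectangle:
  fixes Y :: "'a \<Rightarrow> 'b::topological_space"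
  assumes [measurable]: "Y \<in> borel_measurable M"
    "\<mu> \<in> borel_measurable borel" "v \<in> borel_measurable borel"
    "\<mu>' \<in> borel_measurable borel" "v' \<in> borel_measurable borel"
    and X: "cond_normal M Y X \<mu> v" and X': "cond_normal M Y X' \<mu>' v'"
    and ind: "cond_indep M Y X X'"
    and pos: "AE \<omega> in M. v (Y \<omega>) > 0" "AE \<omega> in M. v' (Y \<omega>) > 0"
    and B [measurable]: "B \<in> sets borel" and C [measurable]: "C \<in> sets borel"
  shows "emeasure M {\<omega> \<in> space M. X \<omega> \<in> B \<and> X' \<omega> \<in> C} =
    (\<integral>\<^sup>+\<omega>. gauss_mass (\<mu> (Y \<omega>)) (v (Y \<omega>)) B * gauss_mass (\<mu>' (Y \<omega>)) (v' (Y \<omega>)) C \<partial>M)"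
proof -
  have [measurable]: "X \<in> borel_measurable M" "X' \<in> borel_measurable M"
    using X X' by (auto simp: cond_normal_def)
  define F where "F = vimage_algebra (space M) Y borel"
  have "subalgebra M F"
    unfolding subalgebra_def F_def using measurable_sets[OF \<open>Y \<in> borel_measurable M\<close>]
    by (auto simp: sets_vimage_algebra2)
  then interpret finite_measure_subalgebra M F
    by unfold_locales
  let ?E = "{\<omega> \<in> space M. X \<omega> \<in> B \<and> X' \<omega> \<in> C}"
  let ?g = "\<lambda>\<omega>. gauss_mass (\<mu> (Y \<omega>)) (v (Y \<omega>)) B * gauss_mass (\<mu>' (Y \<omega>)) (v' (Y \<omega>)) C"
  have AE_eq: "AE \<omega> in M. real_cond_exp M F (indicator ?E) \<omega> = enn2real (?g \<omega>)"
  proof -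
    have "AE \<omega> in M. cond_prob_given M Y {\<omega> \<in> space M. X \<omega> \<in> B} \<omega> = enn2real (gauss_mass (\<mu> (Y \<omega>)) (v (Y \<omega>)) B)"
      using X by (simp add: cond_normal_def measure_def emeasure_normal)
    moreover have "AE \<omega> in M. cond_prob_given M Y {\<omega> \<in> space M. X' \<omega> \<in> C} \<omega> = enn2real (gauss_mass (\<mu>' (Y \<omega>)) (v' (Y \<omega>)) C)"
      using X' by (simp add: cond_normal_def measure_def emeasure_normal)
    moreover have "AE \<omega> in M. cond_prob_given M Y ?E \<omega> =
        cond_prob_given M Y {\<omega> \<in> space M. X \<omega> \<in> B} \<omega> * cond_prob_given M Y {\<omega> \<in> space M. X' \<omega> \<in> C} \<omega>"
      using ind by (simp add: cond_indep_def)
    ultimately show ?thesis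
      by eventually_elim (simp add: cond_prob_given_def F_def enn2real_mult)
  qed
  \<comment> \<open>Positivity of the variances enters here: the masses are then at most 1, so
    \<open>enn2real\<close> loses nothing and the real expectation can be turned back into a
    nonnegative integral.\<close>
  have le: "AE \<omega> in M. ?g \<omega> \<le> 1"
    using pos by eventually_elim (auto intro!: mult_le_one gauss_mass_le_1)
  have int: "integrable M (indicator ?E :: 'a \<Rightarrow> real)"
    by (rule integrable_const_bound[where B = 1]) auto
  have "emeasure M ?E = ennreal (\<integral>\<omega>. indicator ?E \<omega> \<partial>M)"
    by (simp add: emeasure_eq_measure)
  also have "(\<integral>\<omega>. indicator ?E \<omega> \<partial>M) = (\<integral>\<omega>. real_cond_exp M F (indicator ?E) \<omega> \<partial>M)"
    using real_cond_exp_int(2)[OF int] by simp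
  also have "\<dots> = (\<integral>\<omega>. enn2real (?g \<omega>) \<partial>M)"
    by (rule integral_cong_AE) (use AE_eq in auto)
  also have "ennreal \<dots> = (\<integral>\<^sup>+\<omega>. ennreal (enn2real (?g \<omega>)) \<partial>M)"
  proof (rule nn_integral_eq_integral[symmetric])
    show "integrable M (\<lambda>\<omega>. enn2real (?g \<omega>))"
    proof (rule integrable_const_bound[where B = 1])
      show "AE \<omega> in M. norm (enn2real (?g \<omega>)) \<le> 1"
        using le by eventually_elim (use enn2real_mono[of _ 1] in auto)
    qed measurable
  qed simp
  also have "\<dots> = (\<integral>\<^sup>+\<omega>. ?g \<omega> \<partial>M)"
    by (rule nn_integral_cong_AE) (use le in eventually_elim, auto simp: ennreal_enn2real_if top_unique)
  finally show ?thesis .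
qed

section \<open>Averaging over the SNRs and the relay symbol\<close>

lemma (in prob_space) AE_exponential_pos:
  assumes "distributed M lborel X (\<lambda>s. ennreal (exponential_density l s))"
  shows "AE \<omega> in M. X \<omega> > 0"
proof -
  have "AE s in lborel. 0 < ennreal (exponential_density l s) \<longrightarrow> 0 < s"
    by (rule AE_mp[OF AE_lborel_singleton[of 0]]) (auto simp: exponential_density_def)
  then show ?thesis using distributed_AE2[OF assms, of "\<lambda>s. 0 < s"] by simp
qed

text \<open>Transfer to the law of \<open>X\<close>, then Tonelli; this is where
  \<open>fading_density\<close> arises from the model.\<close>

lemma (in prob_space) nn_integral_gauss_mass_exponential:
  assumes X: "distributed M lborel X (\<lambda>s. ennreal (exponential_density (1 / G) s))"
    and [measurable]: "B \<in> sets borel"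
  shows "(\<integral>\<^sup>+\<omega>. gauss_mass (X \<omega> * z) (X \<omega> * d\<^sup>2) B \<partial>M) = (\<integral>\<^sup>+s. fading_density G z d s * indicator B s \<partial>lborel)"
  by (subst distributed_nn_integral[OF X, symmetric]) (simp_all add: nn_integral_fading_density gauss_mass_def)

text \<open>The conditional mass of \<open>t\<close> depends jointly on \<open>xr\<close> and
  \<open>grd\<close>. Splitting on the value of \<open>xr\<close> turns the expectation into a
  finite sum of products of functions of one variable each, and independence factors every summand.
  The factor of \<open>t0\<close> is common to all summands, so the result is a product.\<close>

lemma (in prob_space) relay_rectangle:
  fixes x :: "'i \<Rightarrow> complex" and y :: real
  assumes I: "finite I" and inj: "inj_on x I"
    and pw: "\<And>i. i \<in> I \<Longrightarrow> measure M {\<omega> \<in> space M. xr \<omega> = x i} = pw i"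
    and pw1: "(\<Sum>i\<in>I. pw i) = 1" and d: "d \<noteq> 0"
    and gsd: "distributed M lborel gsd (\<lambda>s. ennreal (exponential_density (1 / Gsd) s))"
    and grd: "distributed M lborel grd (\<lambda>s. ennreal (exponential_density (1 / Grd) s))"
    and indep: "indep_vars (\<lambda>_. borel)
       (\<lambda>k. [xr, \<lambda>\<omega>. complex_of_real (gsd \<omega>), \<lambda>\<omega>. complex_of_real (grd \<omega>)] ! k) {..<3::nat}"
    and t0: "cond_normal M (\<lambda>\<omega>. (xr \<omega>, gsd \<omega>, grd \<omega>)) t0
          (\<lambda>(r, a, b). a * y) (\<lambda>(r, a, b). a * (cmod d)\<^sup>2)"
    and t: "cond_normal M (\<lambda>\<omega>. (xr \<omega>, gsd \<omega>, grd \<omega>)) t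
          (\<lambda>(r, a, b). b * Re (cnj r * d)) (\<lambda>(r, a, b). b * (cmod d)\<^sup>2)"
    and ci: "cond_indep M (\<lambda>\<omega>. (xr \<omega>, gsd \<omega>, grd \<omega>)) t0 t"
    and B [measurable]: "B \<in> sets borel" and C [measurable]: "C \<in> sets borel"
  shows "emeasure M {\<omega> \<in> space M. t0 \<omega> \<in> B \<and> t \<omega> \<in> C} =
    (\<integral>\<^sup>+s. fading_density Gsd y (cmod d) s * indicator B s \<partial>lborel) *
    (\<Sum>i\<in>I. ennreal (pw i) * (\<integral>\<^sup>+s. fading_density Grd (Re (cnj (x i) * d)) (cmod d) s * indicator C s \<partial>lborel))"
proof -
  have xr [measurable]: "xr \<in> borel_measurable M"
  proof -
    have "\<forall>k\<in>{..<3::nat}. random_variable borel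
        ([xr, \<lambda>\<omega>. complex_of_real (gsd \<omega>), \<lambda>\<omega>. complex_of_real (grd \<omega>)] ! k)"
      using indep by (auto simp: indep_vars_def)
    from bspec[OF this, of 0] show ?thesis by simp
  qed
  have [measurable]: "gsd \<in> borel_measurable M" "grd \<in> borel_measurable M"
    using gsd grd by (auto simp: distributed_def)
  have Y: "(\<lambda>\<omega>. (xr \<omega>, gsd \<omega>, grd \<omega>)) \<in> borel_measurable M"
    by measurable
  have pos: "AE \<omega> in M. gsd \<omega> > 0" "AE \<omega> in M. grd \<omega> > 0"
    by (rule AE_exponential_pos[OF gsd] AE_exponential_pos[OF grd])+
  let ?N0 = "\<lambda>a. gauss_mass (a * y) (a * (cmod d)\<^sup>2) B"
  let ?N1 = "\<lambda>r b. gauss_mass (b * Re (cnj r * d)) (b * (cmod d)\<^sup>2) C"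
  have "emeasure M {\<omega> \<in> space M. t0 \<omega> \<in> B \<and> t \<omega> \<in> C} =
      (\<integral>\<^sup>+\<omega>. ?N0 (gsd \<omega>) * ?N1 (xr \<omega>) (grd \<omega>) \<partial>M)"
  proof (subst cond_normal_rectangle[OF Y _ _ _ _ t0 t ci _ _ B C])
    show "AE \<omega> in M. 0 < (case (xr \<omega>, gsd \<omega>, grd \<omega>) of (r, a, b) \<Rightarrow> a * (cmod d)\<^sup>2)"
      using pos(1) by eventually_elim (use d in simp)
    show "AE \<omega> in M. 0 < (case (xr \<omega>, gsd \<omega>, grd \<omega>) of (r, a, b) \<Rightarrow> b * (cmod d)\<^sup>2)"
      using pos(2) by eventually_elim (use d in simp)
  qed (auto intro!: borel_measurable_continuous_onI continuous_intros simp: split_beta)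
  also have "\<dots> = (\<integral>\<^sup>+\<omega>. (\<Sum>i\<in>I. indicator {x i} (xr \<omega>) * ?N0 (gsd \<omega>) * ?N1 (x i) (grd \<omega>)) \<partial>M)"
  proof (rule nn_integral_cong_AE)
    \<comment> \<open>The weights sum to 1 and \<open>x\<close> is injective on \<open>I\<close>, so
      \<open>xr\<close> almost surely takes one of the values \<open>x i\<close>. Injectivity also
      ensures that exactly one indicator in the sum survives.\<close>
    have "prob {\<omega> \<in> space M. xr \<omega> \<in> x ` I} = (\<Sum>i\<in>I. prob {\<omega> \<in> space M. xr \<omega> = x i})"
    proof -
      have "{\<omega> \<in> space M. xr \<omega> \<in> x ` I} = (\<Union>i\<in>I. {\<omega> \<in> space M. xr \<omega> = x i})" by auto
      then show ?thesis
        using I inj by (simp, intro finite_measure_finite_Union)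
          (auto simp: disjoint_family_on_def inj_on_def)
    qed
    then have "prob {\<omega> \<in> space M. xr \<omega> \<in> x ` I} = 1" using pw pw1 by simp
    then have "AE \<omega> in M. \<omega> \<in> {\<omega> \<in> space M. xr \<omega> \<in> x ` I}"
      by (rule AE_prob_1)
    then show "AE \<omega> in M. ?N0 (gsd \<omega>) * ?N1 (xr \<omega>) (grd \<omega>) =
        (\<Sum>i\<in>I. indicator {x i} (xr \<omega>) * ?N0 (gsd \<omega>) * ?N1 (x i) (grd \<omega>))"
    proof eventually_elim
      case (elim \<omega>)
      then obtain j where j: "j \<in> I" "xr \<omega> = x j" by auto
      have "(\<Sum>i\<in>I. indicator {x i} (xr \<omega>) * ?N0 (gsd \<omega>) * ?N1 (x i) (grd \<omega>)) =
          (\<Sum>i\<in>I. if i = j then ?N0 (gsd \<omega>) * ?N1 (x j) (grd \<omega>) else 0)"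
        by (rule sum.cong) (use j inj in \<open>auto simp: indicator_def inj_on_def\<close>)
      then show ?case using j I by simp
    qed
  qed
  also have "\<dots> = (\<Sum>i\<in>I. \<integral>\<^sup>+\<omega>. indicator {x i} (xr \<omega>) * ?N0 (gsd \<omega>) * ?N1 (x i) (grd \<omega>) \<partial>M)"
    by (rule nn_integral_sum) measurable
  also have "\<dots> = (\<Sum>i\<in>I. ennreal (pw i) * (\<integral>\<^sup>+\<omega>. ?N0 (gsd \<omega>) \<partial>M) * (\<integral>\<^sup>+\<omega>. ?N1 (x i) (grd \<omega>) \<partial>M))"
  proof (rule sum.cong[OF refl])
    fix i assume i: "i \<in> I"
    \<comment> \<open>\<open>Re\<close> undoes the embedding of the SNRs into the complex numbers
      that gave the independent family a common value type.\<close>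
    define \<phi> where "\<phi> k = [\<lambda>r. indicator {x i} r, \<lambda>c. ?N0 (Re c), \<lambda>c. ?N1 (x i) (Re c)] ! k" for k
    have "indep_vars (\<lambda>_. borel) (\<lambda>k \<omega>. \<phi> k
       (([xr, \<lambda>\<omega>. complex_of_real (gsd \<omega>), \<lambda>\<omega>. complex_of_real (grd \<omega>)] ! k) \<omega>)) {..<3::nat}"
    proof (rule indep_vars_compose2[OF indep])
      fix k :: nat assume "k \<in> {..<3}"
      then have "k = 0 \<or> k = 1 \<or> k = 2" by auto
      then show "\<phi> k \<in> borel_measurable borel"
        unfolding \<phi>_def by (elim disjE) simp_all
    qed
    note nn = indep_vars_nn_integral[OF _ this]
    have "(\<integral>\<^sup>+\<omega>. indicator {x i} (xr \<omega>) * ?N0 (gsd \<omega>) * ?N1 (x i) (grd \<omega>) \<partial>M) =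
       (\<integral>\<^sup>+\<omega>. indicator {x i} (xr \<omega>) \<partial>M) * (\<integral>\<^sup>+\<omega>. ?N0 (gsd \<omega>) \<partial>M) * (\<integral>\<^sup>+\<omega>. ?N1 (x i) (grd \<omega>) \<partial>M)"
      using nn by (simp add: \<phi>_def eval_nat_numeral lessThan_Suc ac_simps)
    moreover have "(\<integral>\<^sup>+\<omega>. indicator {x i} (xr \<omega>) \<partial>M) = ennreal (pw i)"
    proof -
      have "(\<integral>\<^sup>+\<omega>. indicator {x i} (xr \<omega>) \<partial>M) = (\<integral>\<^sup>+\<omega>. indicator {\<omega> \<in> space M. xr \<omega> = x i} \<omega> \<partial>M)"
        by (rule nn_integral_cong) (auto simp: indicator_def)
      also have "\<dots> = emeasure M {\<omega> \<in> space M. xr \<omega> = x i}"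
        by (rule nn_integral_indicator) measurable
      finally show ?thesis using pw[OF i] by (simp add: emeasure_eq_measure)
    qed
    ultimately show "(\<integral>\<^sup>+\<omega>. indicator {x i} (xr \<omega>) * ?N0 (gsd \<omega>) * ?N1 (x i) (grd \<omega>) \<partial>M) =
       ennreal (pw i) * (\<integral>\<^sup>+\<omega>. ?N0 (gsd \<omega>) \<partial>M) * (\<integral>\<^sup>+\<omega>. ?N1 (x i) (grd \<omega>) \<partial>M)"
      by simp
  qed
  finally show ?thesis
    by (simp only: nn_integral_gauss_mass_exponential[OF gsd B] nn_integral_gauss_mass_exponential[OF grd C]
        sum_distrib_left mult.left_commute mult.assoc)
qed

section \<open>The law of the clipped sum\<close>

lemma borel_measurable_f_PL [measurable]: "f_PL T \<in> borel_measurable borel"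
  unfolding f_PL_def by measurable

text \<open>The rectangle formula makes the joint law a product. For fixed \<open>Y = w\<close> the
  error event is \<open>X > - f_PL T w\<close>, of probability \<open>F (- f_PL T w)\<close>; this
  is constant in \<open>w\<close> on both clipped tails, where the integral therefore
  factors.\<close>

lemma (in prob_space) emeasure_clipped_sum:
  assumes [measurable]: "X \<in> borel_measurable M" "Y \<in> borel_measurable M"
    "f \<in> borel_measurable borel" "g \<in> borel_measurable borel"
    and f1: "(\<integral>\<^sup>+s. f s \<partial>lborel) = 1" and g1: "(\<integral>\<^sup>+w. g w \<partial>lborel) = 1"
    and rect: "\<And>B C. B \<in> sets borel \<Longrightarrow> C \<in> sets borel \<Longrightarrow>
      emeasure M {\<omega> \<in> space M. X \<omega> \<in> B \<and> Y \<omega> \<in> C} =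
      (\<integral>\<^sup>+s. f s * indicator B s \<partial>lborel) * (\<integral>\<^sup>+w. g w * indicator C w \<partial>lborel)"
    and T: "T \<ge> 0"
  defines "F \<equiv> \<lambda>c. \<integral>\<^sup>+s. f s * indicator {c<..} s \<partial>lborel"
  shows "emeasure M {\<omega> \<in> space M. X \<omega> + f_PL T (Y \<omega>) > 0} =
      (\<integral>\<^sup>+w. g w * indicator {..<-T} w \<partial>lborel) * F T +
      (\<integral>\<^sup>+w. g w * indicator {T<..} w \<partial>lborel) * F (- T) +
      (\<integral>\<^sup>+w. g w * (F (- w) * indicator {-T..T} w) \<partial>lborel)"
proof -
  let ?M1 = "density lborel f" and ?M2 = "density lborel g"
  interpret M1: prob_space ?M1
    by (rule prob_spaceI) (simp add: emeasure_density f1)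
  interpret M2: prob_space ?M2
    by (rule prob_spaceI) (simp add: emeasure_density g1)
  interpret pair_sigma_finite ?M1 ?M2 ..
  have joint: "?M1 \<Otimes>\<^sub>M ?M2 = distr M (borel \<Otimes>\<^sub>M borel) (\<lambda>\<omega>. (X \<omega>, Y \<omega>))"
  \<comment> \<open>For sigma-finite factors, agreement on rectangles determines the product
    measure.\<close>
  proof (rule pair_measure_eqI)
    show "sigma_finite_measure ?M1" "sigma_finite_measure ?M2"
      by unfold_locales
    show "sets (?M1 \<Otimes>\<^sub>M ?M2) = sets (distr M (borel \<Otimes>\<^sub>M borel) (\<lambda>\<omega>. (X \<omega>, Y \<omega>)))"
      by (simp cong: sets_pair_measure_cong)
    fix B C assume "B \<in> sets ?M1" "C \<in> sets ?M2"
    then have [measurable]: "B \<in> sets borel" "C \<in> sets borel" by auto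
    have "(\<lambda>\<omega>. (X \<omega>, Y \<omega>)) -` (B \<times> C) \<inter> space M = {\<omega> \<in> space M. X \<omega> \<in> B \<and> Y \<omega> \<in> C}"
      by auto
    then show "emeasure ?M1 B * emeasure ?M2 C =
        emeasure (distr M (borel \<Otimes>\<^sub>M borel) (\<lambda>\<omega>. (X \<omega>, Y \<omega>))) (B \<times> C)"
      by (simp add: emeasure_density emeasure_distr rect)
  qed
  let ?S = "{p. fst p + f_PL T (snd p) > (0::real)}"
  have S: "?S \<in> sets (borel \<Otimes>\<^sub>M borel)"
  proof -
    have "{p \<in> space (borel \<Otimes>\<^sub>M borel). fst p + f_PL T (snd p) > (0::real)} \<in> sets (borel \<Otimes>\<^sub>M borel)"
      by measurable
    then show ?thesis by (simp add: space_pair_measure)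
  qed
  have F_m [measurable]: "F \<in> borel_measurable borel"
  proof -
    have "F = (\<lambda>c. \<integral>\<^sup>+s. f s * (if c < s then 1 else 0) \<partial>lborel)"
      by (simp add: F_def indicator_def if_distrib of_bool_def)
    then show ?thesis by (simp only:) measurable
  qed
  have "(\<lambda>\<omega>. (X \<omega>, Y \<omega>)) -` ?S \<inter> space M = {\<omega> \<in> space M. X \<omega> + f_PL T (Y \<omega>) > 0}"
    by auto
  then have "emeasure M {\<omega> \<in> space M. X \<omega> + f_PL T (Y \<omega>) > 0} =
      emeasure (?M1 \<Otimes>\<^sub>M ?M2) ?S"
    using S unfolding joint by (subst emeasure_distr) auto
  also have "\<dots> = (\<integral>\<^sup>+w. emeasure ?M1 ((\<lambda>s. (s, w)) -` ?S) \<partial>?M2)"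
    by (rule emeasure_pair_measure_alt2) (use S in \<open>simp cong: sets_pair_measure_cong\<close>)
  also have "\<dots> = (\<integral>\<^sup>+w. F (- f_PL T w) \<partial>?M2)"
  proof (rule nn_integral_cong)
    fix w
    have "(\<lambda>s. (s, w)) -` ?S = {- f_PL T w<..}" by auto
    then show "emeasure ?M1 ((\<lambda>s. (s, w)) -` ?S) = F (- f_PL T w)"
      by (simp add: emeasure_density F_def)
  qed
  also have "\<dots> = (\<integral>\<^sup>+w. g w * F (- f_PL T w) \<partial>lborel)"
    by (rule nn_integral_density) measurable
  \<comment> \<open>As \<open>T \<ge> 0\<close>, exactly one of the three indicators is 1 at each
    \<open>w\<close>.\<close>
  also have "\<dots> = (\<integral>\<^sup>+w. (g w * indicator {..<-T} w * F T + g w * indicator {T<..} w * F (- T)) +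
      g w * (F (- w) * indicator {-T..T} w) \<partial>lborel)"
    by (rule nn_integral_cong) (use T in \<open>auto simp: f_PL_def indicator_def\<close>)
  also have "\<dots> = (\<integral>\<^sup>+w. g w * indicator {..<-T} w \<partial>lborel) * F T +
      (\<integral>\<^sup>+w. g w * indicator {T<..} w \<partial>lborel) * F (- T) +
      (\<integral>\<^sup>+w. g w * (F (- w) * indicator {-T..T} w) \<partial>lborel)"
    by (simp add: nn_integral_add nn_integral_multc)
  finally show ?thesis .
qed

section \<open>The four terms of the error probability\<close>

theorem mainTheorem4:
  fixes \<Omega> :: "'a measure" and M p q :: nat and x :: "nat \<Rightarrow> complex" and xbar :: complex
    and z :: "nat \<Rightarrow> real" and \<theta> \<epsilon> T Gsd Grd :: real
    and xr :: "'a \<Rightarrow> complex" and gsd grd t0 t :: "'a \<Rightarrow> real"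
    and Ap Am I1 I2 I3 I4 :: real and Bp Bm :: "nat \<Rightarrow> real"
  assumes "M \<ge> 2"
    and "bij_betw x {1..M} (psk M \<theta>)"
    and "p \<in> {1..M}" and "q \<in> {1..M}" and "x p \<noteq> x q"
    and "xbar = x p - x q"
    and "\<And>i. z i = Re (x i * cnj xbar)"
    and "0 < \<epsilon>" and "\<epsilon> < (real M - 1) / real M"
    and "T = ln ((real M - 1) * (1 - \<epsilon>) / \<epsilon>)"
    and "Gsd > 0" and "Grd > 0"
    and "gaussian_relay_model \<Omega> M x q xbar \<epsilon> Gsd Grd xr gsd grd t0 t"
    and "Ap = 1 / Gsd * (LBINT g:{0<..}. Qfun ((T - z q * g) / (cmod xbar * sqrt g)) * exp (- g / Gsd))"
    and "Am = 1 / Gsd * (LBINT g:{0<..}. Qfun ((- T - z q * g) / (cmod xbar * sqrt g)) * exp (- g / Gsd))"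
    and "\<And>i. Bp i = 1 / Grd * (LBINT g:{0<..}. Qfun ((T + z i * g) / (cmod xbar * sqrt g)) * exp (- g / Grd))"
    and "\<And>i. Bm i = 1 / Grd * (LBINT g:{0<..}. Qfun ((T - z i * g) / (cmod xbar * sqrt g)) * exp (- g / Grd))"
    and "I1 = (1 - \<epsilon>) * Ap * Bp q + \<epsilon> / (real M - 1) * Ap * (\<Sum>i\<in>{1..M} - {q}. Bp i)"
    and "I2 = (1 - \<epsilon>) * Am * Bm q + \<epsilon> / (real M - 1) * Am * (\<Sum>i\<in>{1..M} - {q}. Bm i)"
    and "I3 = (1 - \<epsilon>) / (Gsd * Grd) *
      (LBINT a:{0<..}. LBINT b:{0<..}. 1 / (sqrt (2 * pi * b) * cmod xbar) *
        (LBINT w:{-T..T}. exp (- (w - z q * b)\<^sup>2 / (2 * (cmod xbar)\<^sup>2 * b)) *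
           Qfun ((- w - z q * a) / (cmod xbar * sqrt a)) * exp (- a / Gsd - b / Grd)))"
    and "I4 = \<epsilon> / (Gsd * Grd) *
      (LBINT a:{0<..}. LBINT b:{0<..}. 1 / (sqrt (2 * pi * b) * cmod xbar * (real M - 1)) *
        (LBINT w:{-T..T}. Qfun ((- w - z q * a) / (cmod xbar * sqrt a)) *
           (\<Sum>i\<in>{1..M} - {q}. exp (- (w - z i * b)\<^sup>2 / (2 * (cmod xbar)\<^sup>2 * b))) *
           exp (- a / Gsd - b / Grd)))"
  shows "measure \<Omega> {\<omega> \<in> space \<Omega>. t0 \<omega> + f_PL T (t \<omega>) > 0} = I1 + I2 + I3 + I4"
proof -
  note A = assms
  have M: "real M - 1 > 0" using A(1) by simp
  have "(real M - 1) / real M < 1" using A(1) by simp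
  then have eps: "0 < \<epsilon>" "\<epsilon> < 1" "\<epsilon> * real M < real M - 1"
    using A(8,9) M by (linarith, linarith, simp add: field_simps)
  have T: "T \<ge> 0"
  proof -
    \<comment> \<open>Cleared of denominators this is
      \<open>\<epsilon> * real M \<le> real M - 1\<close>, which the upper bound on
      \<open>\<epsilon>\<close> provides.\<close>
    have "1 \<le> (real M - 1) * (1 - \<epsilon>) / \<epsilon>"
      using eps by (simp add: field_simps)
    then show ?thesis unfolding A(10) by (rule ln_ge_zero)
  qed
  have inj: "inj_on x {1..M}" using A(2) by (simp add: bij_betw_def)
  have d: "xbar \<noteq> 0" "cmod xbar > 0" using A(5,6) by auto
  \<comment> \<open>The two products are complex conjugates and share their real part, so the means
    in the model are multiples of the \<open>z i\<close>.\<close>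
  have zi: "Re (cnj (x i) * xbar) = z i" for i
    by (simp add: A(7))
  have model: "prob_space \<Omega>"
     "measure \<Omega> {\<omega> \<in> space \<Omega>. xr \<omega> = x q} = 1 - \<epsilon>"
     "\<And>i. i \<in> {1..M} - {q} \<Longrightarrow> measure \<Omega> {\<omega> \<in> space \<Omega>. xr \<omega> = x i} = \<epsilon> / (real M - 1)"
     "distributed \<Omega> lborel gsd (\<lambda>s. ennreal (exponential_density (1 / Gsd) s))"
     "distributed \<Omega> lborel grd (\<lambda>s. ennreal (exponential_density (1 / Grd) s))"
     "prob_space.indep_vars \<Omega> (\<lambda>_. borel)
       (\<lambda>k. [xr, \<lambda>\<omega>. complex_of_real (gsd \<omega>), \<lambda>\<omega>. complex_of_real (grd \<omega>)] ! k) {..<3::nat}"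
     "cond_normal \<Omega> (\<lambda>\<omega>. (xr \<omega>, gsd \<omega>, grd \<omega>)) t0
          (\<lambda>(r, a, b). a * z q) (\<lambda>(r, a, b). a * (cmod xbar)\<^sup>2)"
     "cond_normal \<Omega> (\<lambda>\<omega>. (xr \<omega>, gsd \<omega>, grd \<omega>)) t
          (\<lambda>(r, a, b). b * Re (cnj r * xbar)) (\<lambda>(r, a, b). b * (cmod xbar)\<^sup>2)"
     "cond_indep \<Omega> (\<lambda>\<omega>. (xr \<omega>, gsd \<omega>, grd \<omega>)) t0 t"
    using A(13) unfolding gaussian_relay_model_def Let_def zi by blast+
  interpret prob_space \<Omega> by (rule model(1))
  define I where "I = {1..M} - {q}"
  have I: "finite I" "q \<notin> I" "{1..M} = insert q I" using A(4) by (auto simp: I_def)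
  have cardI: "real (card I) = real M - 1"
    using A(1,4) by (simp add: I_def of_nat_diff)
  define pw where "pw i = (if i = q then 1 - \<epsilon> else \<epsilon> / (real M - 1))" for i
  \<comment> \<open>Stated for arbitrary \<open>c\<close> to serve the total mass of
    \<open>t\<close> (\<open>c = 1\<close>) and both of its tails (\<open>c = Bp\<close> and
    \<open>c = Bm\<close>).\<close>
  have pw_sum: "(\<Sum>i\<in>{1..M}. pw i * c i) = (1 - \<epsilon>) * c q + \<epsilon> / (real M - 1) * (\<Sum>i\<in>I. c i)" for c
  proof -
    have "(\<Sum>i\<in>I. pw i * c i) = (\<Sum>i\<in>I. \<epsilon> / (real M - 1) * c i)"
      using I by (intro sum.cong) (auto simp: pw_def)
    then show ?thesis using I by (simp add: pw_def sum_distrib_left)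
  qed
  have pw1: "(\<Sum>i\<in>{1..M}. pw i) = 1"
    using pw_sum[of "\<lambda>_. 1"] M cardI by simp
  have pw0: "0 \<le> pw i" for i using eps M by (simp add: pw_def)
  have pw: "measure \<Omega> {\<omega> \<in> space \<Omega>. xr \<omega> = x i} = pw i" if "i \<in> {1..M}" for i
    using model(2,3) that by (auto simp: pw_def)
  \<comment> \<open>\<open>f\<close> and \<open>g\<close> are the unconditional densities of
    \<open>t0\<close> and \<open>t\<close>; the latter is a mixture over the relay symbols.\<close>
  define f where "f = fading_density Gsd (z q) (cmod xbar)"
  define \<psi> where "\<psi> i = fading_density Grd (z i) (cmod xbar)" for i
  define g where "g w = (\<Sum>i\<in>{1..M}. ennreal (pw i) * \<psi> i w)" for w
  have f_m [measurable]: "f \<in> borel_measurable borel" and [measurable]: "\<psi> i \<in> borel_measurable borel" for i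
    by (simp_all add: f_def \<psi>_def)
  have g_m [measurable]: "g \<in> borel_measurable borel"
    unfolding g_def by measurable
  have g_int: "(\<integral>\<^sup>+w. g w * h w \<partial>lborel) = (\<Sum>i\<in>{1..M}. ennreal (pw i) * (\<integral>\<^sup>+w. \<psi> i w * h w \<partial>lborel))"
    if [measurable]: "h \<in> borel_measurable borel" for h
    by (simp add: g_def sum_distrib_right nn_integral_sum nn_integral_cmult mult.assoc)
  have g1: "(\<integral>\<^sup>+w. g w \<partial>lborel) = 1"
    using g_int[of "\<lambda>_. 1"] pw1 A(12) d
    by (simp add: \<psi>_def nn_integral_fading_density_UNIV pw0 sum_ennreal)
  have f1: "(\<integral>\<^sup>+w. f w \<partial>lborel) = 1"
    using A(11) d by (simp add: f_def nn_integral_fading_density_UNIV)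
  have m: "t0 \<in> borel_measurable \<Omega>" "t \<in> borel_measurable \<Omega>"
    using model(7,8) by (auto simp: cond_normal_def)
  have rect: "emeasure \<Omega> {\<omega> \<in> space \<Omega>. t0 \<omega> \<in> B \<and> t \<omega> \<in> C} =
      (\<integral>\<^sup>+s. f s * indicator B s \<partial>lborel) * (\<integral>\<^sup>+w. g w * indicator C w \<partial>lborel)"
    if "B \<in> sets borel" "C \<in> sets borel" for B C
    using relay_rectangle[OF _ inj pw pw1 d(1) model(4-9) that, unfolded zi] that
    by (simp add: f_def g_int \<psi>_def)
  define F where "F c = (\<integral>\<^sup>+s. f s * indicator {c<..} s \<partial>lborel)" for c
  have Fp: "F T = ennreal Ap" and Fm: "F (- T) = ennreal Am"
    using A(11) d by (simp_all only: F_def f_def fading_density_greaterThan A(14,15))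
  have F_mix: "F (- w) = (\<integral>\<^sup>+a. ennreal (exponential_density (1 / Gsd) a) *
          ennreal (Qfun ((- w - z q * a) / (cmod xbar * sqrt a))) \<partial>lborel)" for w
    using d by (simp only: F_def f_def fading_density_greaterThan_mixture)
  have nonneg: "0 \<le> Ap" "0 \<le> Am" "0 \<le> Bp i" "0 \<le> Bm i" for i
    unfolding A(14-17) using A(11,12)
    by (auto intro!: mult_nonneg_nonneg divide_nonneg_nonneg set_integral_nonneg_pointwise)
  \<comment> \<open>A lower tail at \<open>c = - T\<close> has
    \<open>z i * b - c = T + z i * b\<close> in the argument of \<open>Qfun\<close>, which is the
    plus sign of \<open>Bp\<close>.\<close>
  have Bp_eq: "(\<integral>\<^sup>+w. \<psi> i w * indicator {..<-T} w \<partial>lborel) = ennreal (Bp i)" for i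
    using A(12) d by (simp add: \<psi>_def fading_density_lessThan A(16) add.commute)
  have Bm_eq: "(\<integral>\<^sup>+w. \<psi> i w * indicator {T<..} w \<partial>lborel) = ennreal (Bm i)" for i
    using A(12) d by (simp only: \<psi>_def fading_density_greaterThan A(17))
  \<comment> \<open>Here \<open>t\<close> is clipped to \<open>- T\<close>, so an error requires
    \<open>t0 > T\<close>; hence \<open>Ap\<close> is paired with \<open>Bp\<close>.\<close>
  have lower: "(\<integral>\<^sup>+w. g w * indicator {..<-T} w \<partial>lborel) * F T = ennreal I1"
  proof -
    have g: "(\<integral>\<^sup>+w. g w * indicator {..<-T} w \<partial>lborel) = ennreal (\<Sum>i\<in>{1..M}. pw i * Bp i)"
      by (simp add: g_int Bp_eq pw0 nonneg flip: ennreal_mult)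
    show ?thesis
      unfolding g pw_sum Fp A(18) I_def[symmetric] using nonneg
      by (subst ennreal_mult''[symmetric]) (simp_all add: algebra_simps)
  qed
  \<comment> \<open>Here \<open>t\<close> is clipped to \<open>T\<close>, so \<open>t0 > - T\<close>
    suffices for an error; hence \<open>Am\<close> is paired with \<open>Bm\<close>.\<close>
  have upper: "(\<integral>\<^sup>+w. g w * indicator {T<..} w \<partial>lborel) * F (- T) = ennreal I2"
  proof -
    have g: "(\<integral>\<^sup>+w. g w * indicator {T<..} w \<partial>lborel) = ennreal (\<Sum>i\<in>{1..M}. pw i * Bm i)"
      by (simp add: g_int Bm_eq pw0 nonneg flip: ennreal_mult)
    show ?thesis
      unfolding g pw_sum Fm A(19) I_def[symmetric] using nonneg
      by (subst ennreal_mult''[symmetric]) (simp_all add: algebra_simps)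
  qed
  have F_m [measurable]: "(\<lambda>w. F (- w)) \<in> borel_measurable borel"
    unfolding F_mix by measurable
  \<comment> \<open>Used twice: with index set \<open>{q}\<close> and \<open>k = 1\<close> for
    \<open>I3\<close>, and with index set \<open>I\<close> and \<open>k = real M - 1\<close> for
    \<open>I4\<close>. The contribution of \<open>x q\<close> is therefore written below as a sum
    over a singleton.\<close>
  note mid = middle_region_integral[OF A(11,12) d(2), of _ _ z "z q" T, folded F_mix \<psi>_def]
  have middle: "(\<integral>\<^sup>+w. g w * (F (- w) * indicator {-T..T} w) \<partial>lborel) = ennreal I3 + ennreal I4"
  proof -
    let ?h = "\<lambda>w. F (- w) * indicator {-T..T} w"
    have "(\<integral>\<^sup>+w. g w * ?h w \<partial>lborel) = ennreal (1 - \<epsilon>) * (\<integral>\<^sup>+w. (\<Sum>i\<in>{q}. \<psi> i w) * ?h w \<partial>lborel) +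
        (\<Sum>i\<in>I. ennreal (pw i) * (\<integral>\<^sup>+w. \<psi> i w * ?h w \<partial>lborel))"
      using I by (simp add: g_int pw_def)
    also have "(\<Sum>i\<in>I. ennreal (pw i) * (\<integral>\<^sup>+w. \<psi> i w * ?h w \<partial>lborel)) =
        (\<Sum>i\<in>I. ennreal (\<epsilon> / (real M - 1)) * (\<integral>\<^sup>+w. \<psi> i w * ?h w \<partial>lborel))"
      using I by (intro sum.cong) (auto simp: pw_def)
    also have "\<dots> = ennreal (\<epsilon> / (real M - 1)) * (\<integral>\<^sup>+w. (\<Sum>i\<in>I. \<psi> i w) * ?h w \<partial>lborel)"
      by (simp add: sum_distrib_left[symmetric] sum_distrib_right nn_integral_sum)
    also have "ennreal (1 - \<epsilon>) * (\<integral>\<^sup>+w. (\<Sum>i\<in>{q}. \<psi> i w) * ?h w \<partial>lborel) = ennreal I3"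
      unfolding mid[OF zero_less_one finite.insertI[OF finite.emptyI]] A(20)
      using eps by (subst ennreal_mult'[symmetric]) (simp_all add: ac_simps)
    also have "ennreal (\<epsilon> / (real M - 1)) * (\<integral>\<^sup>+w. (\<Sum>i\<in>I. \<psi> i w) * ?h w \<partial>lborel) = ennreal I4"
      unfolding mid[OF M I(1)] A(21) I_def[symmetric]
      using eps M by (subst ennreal_mult'[symmetric]) simp_all
    finally show ?thesis .
  qed
  \<comment> \<open>\<open>ennreal\<close> truncates negative reals to 0, so the four terms can be
    added as reals only once their signs are known.\<close>
  have I_nonneg: "0 \<le> I1" "0 \<le> I2" "0 \<le> I3" "0 \<le> I4"
    unfolding A(18-21) using nonneg eps M A(11,12)
    by (auto intro!: add_nonneg_nonneg mult_nonneg_nonneg divide_nonneg_nonneg sum_nonneg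
        set_integral_nonneg_pointwise)
  have "emeasure \<Omega> {\<omega> \<in> space \<Omega>. t0 \<omega> + f_PL T (t \<omega>) > 0} =
      ennreal I1 + ennreal I2 + (ennreal I3 + ennreal I4)"
    by (rule emeasure_clipped_sum[OF m f_m g_m f1 g1 rect T, folded F_def, unfolded lower upper middle])
  also have "\<dots> = ennreal (I1 + I2 + I3 + I4)"
    using I_nonneg by (simp add: add.assoc flip: ennreal_plus)
  finally show ?thesis
    using I_nonneg by (simp only: measure_def enn2real_ennreal add_nonneg_nonneg)
qed

end
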